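(* Fix $s$ marked permutations $(p_1,h_1),\ldots,(p_s,h_s)\in\mathcal{S}'$, and a polynomial $f(x_1,\ldots,x_s)\in\Lambda[x_1,\ldots,x_s]$. The permutation statistic $$\sum_{i=1}^\infty f\big([(p_1,h_1),i],\ldots,[(p_s,h_s),i]\big)$$ is pattern-finite.
   Context: $\Lambda$ is a unital commutative ring. $S_n$ is the set of permutations of $[1,n]=\{1,\dots,n\}$ (with $S_0=\{\varnothing\}$), $\mathcal{S}=\bigsqcup_{n\ge 0}S_n$, and $|w|=n$ for $w\in S_n$. A $\Lambda$-valued permutation statistic is any function $\mathcal{S}\to\Lambda$; these form the $\Lambda$-algebra $\Lambda^{\mathcal S}$ under pointwise addition and multiplication. For $p\in S_k$ and $w\in S_n$, an occurrence of $p$ in $w$ is a subword $w(i_1)\cdots w(i_k)$ at indices $1\le i_1<\dots<i_k\le n$ that is order isomorphic to $p(1)\cdots p(k)$; the pattern-count function $[p]\colon\mathcal{S}\to\mathbb{N}$ sends $w$ to the number of occurrences of $p$ in $w$ (so $[\varnothing]$ is constantly $1$), and is regarded as $\Lambda$-valued via the unital ring map $\mathbb{Z}\to\Lambda$. Every statistic is uniquely a (possibly infinite) $\Lambda$-linear combination of pattern-count functions, called its pattern expansion; the statistic is pattern-finite if only finitely many coefficients in this expansion are nonzero. A marked permutation is a pair $(p,h)$ with $p\in\mathcal{S}$ and $1\le h\le |p|$; $\mathcal{S}'$ is the set of all marked permutations. For $i\ge 1$ and $(p,h)\in\mathcal{S}'$, an $i$-calibrated occurrence of $(p,h)$ in $w$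 is an occurrence $w(i_1)\cdots w(i_{|p|})$ of $p$ in $w$ with $i_h=i$. The $i$-pattern-count function $[(p,h),i]\colon\mathcal{S}\to\mathbb{N}$ sends $w$ to the number of $i$-calibrated occurrences of $(p,h)$ in $w$; it is also regarded as $\Lambda$-valued.
   Formalization: For i > |w| the i-th term is the constant coefficient of f, so the infinite sum is undefined unless that coefficient is 0; this is assumed for the infinite sum, and for arbitrary f the sum over i = 1,…,|w| is shown to be pattern-finite. *)

theory Defs
  imports Complex_Main "HOL-Combinatorics.Permutations" "HOL-Library.FuncSet" "HOL-Library.Poly_Mapping"
begin

text \<open>
  The type of all permutations of all the sets \<open>{1..n}\<close>. The size is recorded explicitly, because
  \<open>\<sigma> permutes {1..n}\<close> (with \<open>\<sigma>\<close> the identity outside \<open>{1..n}\<close>) does not determine \<open>n\<close>.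
\<close>

typedef finperm = "{(n :: nat, \<sigma> :: nat \<Rightarrow> nat). \<sigma> permutes {1..n}}"
  by (rule exI[of _ "(0, id)"]) (simp add: permutes_id)

definition psize :: "finperm \<Rightarrow> nat" where
  "psize w = fst (Rep_finperm w)"

definition papply :: "finperm \<Rightarrow> nat \<Rightarrow> nat" where
  "papply w = snd (Rep_finperm w)"

text \<open>
  An occurrence of \<open>p\<close> in \<open>w\<close> is given by its index sequence \<open>\<iota> 1 < \<dots> < \<iota> (psize p)\<close>, a function
  that is \<open>undefined\<close> outside \<open>{1..psize p}\<close> so that different functions are different occurrences.
\<close>

definition occurrences :: "finperm \<Rightarrow> finperm \<Rightarrow> (nat \<Rightarrow> nat) set" where
  "occurrences p w =
     {\<iota> \<in> {1..psize p} \<rightarrow>\<^sub>E {1..psize w}.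
        strict_mono_on {1..psize p} \<iota> \<and>
        (\<forall>a\<in>{1..psize p}. \<forall>b\<in>{1..psize p}.
           papply p a < papply p b \<longleftrightarrow> papply w (\<iota> a) < papply w (\<iota> b))}"

definition pattern_count :: "finperm \<Rightarrow> finperm \<Rightarrow> nat" where
  "pattern_count p w = card (occurrences p w)"

text \<open>
  In a pattern expansion \<open>g = (\<Sum>p. c p * [p])\<close> only the finitely many patterns that occur in \<open>w\<close>
  contribute to the value at \<open>w\<close> (lemma \<open>finite_occurring_patterns\<close> below).
\<close>

definition is_pattern_expansion :: "(finperm \<Rightarrow> 'a::comm_ring_1) \<Rightarrow> (finperm \<Rightarrow> 'a) \<Rightarrow> bool" where
  "is_pattern_expansion c g \<longleftrightarrow>
     (\<forall>w. g w = (\<Sum>p | pattern_count p w \<noteq> 0. c p * of_nat (pattern_count p w)))"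

text \<open>
  Every statistic has exactly one pattern expansion, so \<open>c\<close> here is the family of its coefficients.
\<close>

definition pattern_finite :: "(finperm \<Rightarrow> 'a::comm_ring_1) \<Rightarrow> bool" where
  "pattern_finite g \<longleftrightarrow> (\<exists>c. is_pattern_expansion c g \<and> finite {p. c p \<noteq> 0})"

definition marked_perms :: "(finperm \<times> nat) set" where
  "marked_perms = {(p, h). 1 \<le> h \<and> h \<le> psize p}"

definition calibrated_count :: "finperm \<times> nat \<Rightarrow> nat \<Rightarrow> finperm \<Rightarrow> nat" where
  "calibrated_count m i w = card {\<iota> \<in> occurrences (fst m) w. \<iota> (snd m) = i}"

text \<open>
  Polynomials in the variables \<open>x\<^sub>1, x\<^sub>2, \<dots>\<close>: a monomial is a finitely supported exponent
  function, and a polynomial is a finitely supported coefficient function on monomials.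
  Its constant coefficient is \<open>Poly_Mapping.lookup f 0\<close>.
\<close>

type_synonym 'a mpoly = "(nat \<Rightarrow>\<^sub>0 nat) \<Rightarrow>\<^sub>0 'a"

definition mpolys :: "nat \<Rightarrow> 'a::comm_ring_1 mpoly set" where
  "mpolys s = {f. \<forall>e \<in> Poly_Mapping.keys f. Poly_Mapping.keys e \<subseteq> {1..s}}"

definition mpoly_eval :: "'a::comm_ring_1 mpoly \<Rightarrow> (nat \<Rightarrow> 'a) \<Rightarrow> 'a" where
  "mpoly_eval f x =
     (\<Sum>e\<in>Poly_Mapping.keys f. Poly_Mapping.lookup f e *
        (\<Prod>j\<in>Poly_Mapping.keys e. x j ^ Poly_Mapping.lookup e j))"

text \<open>The value at \<open>w\<close> of \<open>f ([m 1, i], \<dots>, [m s, i])\<close>, for marked permutations \<open>m j\<close>.\<close>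

definition calibrated_term ::
    "'a::comm_ring_1 mpoly \<Rightarrow> (nat \<Rightarrow> finperm \<times> nat) \<Rightarrow> nat \<Rightarrow> finperm \<Rightarrow> 'a" where
  "calibrated_term f m i w = mpoly_eval f (\<lambda>j. of_nat (calibrated_count (m j) i w))"

lemma papply_permutes: "papply w permutes {1..psize w}"
  using Rep_finperm[of w] by (auto simp: papply_def psize_def)

lemma finite_psize_le: "finite {p. psize p \<le> n}"
proof -
  have "Rep_finperm ` {p. psize p \<le> n} \<subseteq> (SIGMA k:{..n}. {\<sigma>. \<sigma> permutes {1..k}})"
  proof
    fix x assume "x \<in> Rep_finperm ` {p. psize p \<le> n}"
    then obtain p where "psize p \<le> n" "x = (psize p, papply p)"
      by (auto simp: psize_def papply_def)
    then show "x \<in> (SIGMA k:{..n}. {\<sigma>. \<sigma> permutes {1..k}})"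
      using papply_permutes[of p] by auto
  qed
  moreover have "finite (SIGMA k:{..n}. {\<sigma>. \<sigma> permutes {1..k}})"
    by (intro finite_SigmaI finite_permutations) auto
  ultimately have "finite (Rep_finperm ` {p. psize p \<le> n})"
    by (rule finite_subset)
  then show ?thesis
    by (rule finite_imageD) (simp add: inj_on_def Rep_finperm_inject)
qed

lemma finite_occurrences: "finite (occurrences p w)"
  by (rule finite_subset[OF _ finite_PiE[of "{1..psize p}" "\<lambda>_. {1..psize w}"]])
     (auto simp: occurrences_def)

lemma finite_occurring_patterns: "finite {p. pattern_count p w \<noteq> 0}"
proof (rule finite_subset[OF _ finite_psize_le])
  show "{p. pattern_count p w \<noteq> 0} \<subseteq> {p. psize p \<le> psize w}"
  proof
    fix p assume "p \<in> {p. pattern_count p w \<noteq> 0}"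
    then have "occurrences p w \<noteq> {}"
      by (auto simp: pattern_count_def)
    then obtain \<iota> where "\<iota> \<in> {1..psize p} \<rightarrow>\<^sub>E {1..psize w}" "strict_mono_on {1..psize p} \<iota>"
      by (auto simp: occurrences_def)
    then have "card {1..psize p} \<le> card {1..psize w}"
      by (intro card_inj_on_le[of \<iota>]) (auto intro: strict_mono_on_imp_inj_on)
    then show "p \<in> {p. psize p \<le> psize w}"
      by simp
  qed
qed

end

theory Submission imports Defs "HOL-Library.Infinite_Set" begin

text \<open>
  Write \<open>[n]\<close> for \<open>{1..n}\<close> and let \<open>w\<close> have size \<open>n\<close>. Every set \<open>I \<subseteq> [n]\<close> of positions is the image
  of exactly one occurrence in \<open>w\<close> of exactly one pattern, namely the standardization of the subword
  at \<open>I\<close> (\<open>occurrence_at\<close>, \<open>occurrence_unique\<close>). So a statistic of the form \<open>\<Sum>I \<subseteq> [n]. G w I\<close>, where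
  \<open>G w I\<close> depends only on the standardization \<open>p\<close> of \<open>w\<close> at \<open>I\<close>, has the pattern expansion
  \<open>\<Sum>p. G p [psize p] * [p]\<close>, which is finite as soon as \<open>G\<close> vanishes on all large sets
  (\<open>pattern_finite_sum_subsets\<close>).

  The statistics in question have this form because the position \<open>i\<close> can be carried along. Call
  \<open>g i w\<close> \<^emph>\<open>local\<close> if it is a sum over the sets \<open>I\<close> with \<open>i \<in> I \<subseteq> [n]\<close> of contributions that only
  see the subword at \<open>I\<close> and the place of \<open>i\<close> in it, and that vanish on large \<open>I\<close>. Calibrated counts
  are local: each calibrated occurrence contributes \<open>1\<close> to its set of positions. Constants are local
  too, being concentrated on \<open>I = {i}\<close>, and local functions are closed under sums and products: a
  product of contributions of \<open>I\<close> and \<open>J\<close> is attributed to \<open>I \<union> J\<close>, which is again small and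
  contains \<open>i\<close>. Hence every polynomial in calibrated counts is local. Summing over \<open>i\<close> and exchanging
  the two summations gives the form above with \<open>G w I = (\<Sum>i\<in>I. F w i I)\<close>.

  If the polynomial has no constant term, positions \<open>i > n\<close> contribute nothing, so the infinite sum
  over all \<open>i\<close> is the sum over \<open>[n]\<close>.
\<close>


section \<open>Occurrences and sets of positions\<close>

lemma occurrencesD:
  assumes "\<iota> \<in> occurrences p w"
  shows "\<iota> \<in> extensional {1..psize p}" "\<And>a. a \<in> {1..psize p} \<Longrightarrow> \<iota> a \<in> {1..psize w}"
    "strict_mono_on {1..psize p} \<iota>" "inj_on \<iota> {1..psize p}"
    "\<And>a b. a \<in> {1..psize p} \<Longrightarrow> b \<in> {1..psize p} \<Longrightarrow>
       papply p a < papply p b \<longleftrightarrow> papply w (\<iota> a) < papply w (\<iota> b)"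
  using assms by (auto simp: occurrences_def PiE_iff intro: strict_mono_on_imp_inj_on)

lemma occurrence_image_subset:
  "\<iota> \<in> occurrences p w \<Longrightarrow> J \<subseteq> {1..psize p} \<Longrightarrow> \<iota> ` J \<subseteq> {1..psize w}"
  using occurrencesD(2) by blast

lemma card_occurrence_image: "\<iota> \<in> occurrences p w \<Longrightarrow> card (\<iota> ` {1..psize p}) = psize p"
  using card_image[OF occurrencesD(4)] by simp

lemma rank_strict_mono:
  fixes \<iota> :: "nat \<Rightarrow> nat"
  assumes "strict_mono_on {1..k} \<iota>" "a \<in> {1..k}"
  shows "card {x \<in> \<iota> ` {1..k}. x \<le> \<iota> a} = a"
proof -
  have "{x \<in> \<iota> ` {1..k}. x \<le> \<iota> a} = \<iota> ` {1..a}"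
    using assms strict_mono_on_less_eq[OF assms(1)] by (auto simp: image_iff)
  moreover have "inj_on \<iota> {1..a}"
    using assms by (intro inj_on_subset[OF strict_mono_on_imp_inj_on[OF assms(1)]]) auto
  ultimately show ?thesis by (simp add: card_image)
qed

lemma rank_permutes:
  fixes \<sigma> :: "nat \<Rightarrow> nat"
  assumes "\<sigma> permutes {1..k}" "a \<in> {1..k}"
  shows "card {b \<in> {1..k}. \<sigma> b \<le> \<sigma> a} = \<sigma> a"
proof -
  have "\<sigma> ` {b \<in> {1..k}. \<sigma> b \<le> \<sigma> a} = {x \<in> \<sigma> ` {1..k}. x \<le> \<sigma> a}"
    by auto
  also have "\<dots> = {1..\<sigma> a}"
    unfolding permutes_image[OF assms(1)] using permutes_in_image[OF assms(1), of a] assms(2) by auto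
  finally have "card (\<sigma> ` {b \<in> {1..k}. \<sigma> b \<le> \<sigma> a}) = \<sigma> a"
    by simp
  then show ?thesis
    by (simp add: card_image inj_on_subset[OF permutes_inj[OF assms(1)]])
qed

lemma finperm_eqI: "psize p = psize q \<Longrightarrow> papply p = papply q \<Longrightarrow> p = q"
  by (simp add: psize_def papply_def prod_eq_iff flip: Rep_finperm_inject)

text \<open>
  Both the index sequence and the pattern are recovered from ranks: the \<open>a\<close>-th index is the element
  of rank \<open>a\<close> in the image, and \<open>p(a)\<close> is the rank of the \<open>a\<close>-th letter in the subword.
\<close>

lemma occurrence_unique:
  assumes \<iota>: "\<iota> \<in> occurrences p w" and \<kappa>: "\<kappa> \<in> occurrences q w"
    and im: "\<iota> ` {1..psize p} = \<kappa> ` {1..psize q}"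
  shows "p = q" "\<iota> = \<kappa>"
proof -
  have k: "psize p = psize q"
    using card_occurrence_image[OF \<iota>] card_occurrence_image[OF \<kappa>] im by simp
  have eq: "\<iota> a = \<kappa> a" if a: "a \<in> {1..psize p}" for a
  proof -
    obtain b where b: "b \<in> {1..psize q}" "\<iota> a = \<kappa> b"
      using a im by blast
    have "a = b"
      using rank_strict_mono[OF occurrencesD(3)[OF \<iota>] a] rank_strict_mono[OF occurrencesD(3)[OF \<kappa>] b(1)]
      unfolding im b(2) by (rule trans[OF sym])
    then show ?thesis using b by simp
  qed
  show "\<iota> = \<kappa>"
    using occurrencesD(1)[OF \<iota>] occurrencesD(1)[OF \<kappa>] eq k by (intro extensionalityI) auto
  have "papply p a = papply q a" for a
  proof (cases "a \<in> {1..psize p}")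
    case True
    have "{b \<in> {1..psize p}. papply p b \<le> papply p a} = {b \<in> {1..psize q}. papply q b \<le> papply q a}"
      using occurrencesD(5)[OF \<iota>, of a] occurrencesD(5)[OF \<kappa>, of a] True k \<open>\<iota> = \<kappa>\<close>
      by (auto simp flip: not_less)
    then show ?thesis
      using rank_permutes[OF papply_permutes[of p]] rank_permutes[OF papply_permutes[of q]] True k
      by metis
  next
    case False
    then show ?thesis
      using permutes_not_in[OF papply_permutes[of p]] permutes_not_in[OF papply_permutes[of q]] k
      by simp
  qed
  then show "p = q" using k by (intro finperm_eqI) auto
qed

text \<open>The standardization replaces each value by its rank among the values.\<close>

lemma standardization_exists:
  fixes v :: "nat \<Rightarrow> nat"
  assumes inj: "inj_on v {1..k}"
  obtains p where "psize p = k"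
    "\<And>a b. a \<in> {1..k} \<Longrightarrow> b \<in> {1..k} \<Longrightarrow> papply p a < papply p b \<longleftrightarrow> v a < v b"
proof -
  define r where "r a = card {b \<in> {1..k}. v b \<le> v a}" for a
  define \<sigma> where "\<sigma> a = (if a \<in> {1..k} then r a else a)" for a
  have less: "r a < r b" if "a \<in> {1..k}" "b \<in> {1..k}" "v a < v b" for a b
  proof -
    have "b \<in> {c \<in> {1..k}. v c \<le> v b}" "b \<notin> {c \<in> {1..k}. v c \<le> v a}"
      using that by auto
    moreover have "{c \<in> {1..k}. v c \<le> v a} \<subseteq> {c \<in> {1..k}. v c \<le> v b}"
      using that by auto
    ultimately show ?thesis
      unfolding r_def by (intro psubset_card_mono psubsetI) (simp, assumption, metis)
  qed
  have iff: "r a < r b \<longleftrightarrow> v a < v b" if "a \<in> {1..k}" "b \<in> {1..k}" for a b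
  proof (cases "v a = v b")
    case True
    then show ?thesis by (simp add: r_def)
  next
    case False
    then show ?thesis using less[of a b] less[of b a] that by (meson linorder_neqE_nat not_less_iff_gr_or_eq)
  qed
  have inj_r: "inj_on r {1..k}"
    using iff inj unfolding inj_on_def by (metis less_irrefl linorder_neqE_nat)
  have "r a \<in> {1..k}" if "a \<in> {1..k}" for a
  proof -
    have "card {a} \<le> r a" unfolding r_def using that by (intro card_mono) auto
    moreover have "r a \<le> card {1..k}" unfolding r_def by (intro card_mono) auto
    ultimately show ?thesis by simp
  qed
  then have "r ` {1..k} = {1..k}"
    by (intro endo_inj_surj inj_r) auto
  with inj_r have "bij_betw r {1..k} {1..k}"
    by (simp only: bij_betw_def simp_thms)
  then have "bij_betw \<sigma> {1..k} {1..k}"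
    using bij_betw_cong[of "{1..k}" \<sigma> r "{1..k}"] by (simp add: \<sigma>_def del: One_nat_def)
  then have perm: "\<sigma> permutes {1..k}"
    by (rule bij_imp_permutes) (auto simp: \<sigma>_def)
  let ?p = "Abs_finperm (k, \<sigma>)"
  have "Rep_finperm ?p = (k, \<sigma>)"
    using perm by (intro Abs_finperm_inverse) auto
  then have "psize ?p = k" "papply ?p = \<sigma>"
    by (simp_all add: psize_def papply_def)
  with iff show thesis
    by (intro that[of ?p]) (auto simp: \<sigma>_def)
qed

lemma occurrence_at:
  assumes I: "I \<subseteq> {1..psize w}"
  obtains p \<iota> where "\<iota> \<in> occurrences p w" "\<iota> ` {1..psize p} = I"
proof -
  have fin: "finite I" using I finite_subset by blast
  obtain h where h: "bij_betw h {..<card I} I" "strict_mono_on {..<card I} h"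
    using ex_bij_betw_strict_mono_card[OF fin] by blast
  \<comment> \<open>\<open>h\<close> enumerates from \<open>0\<close>, index sequences start at \<open>1\<close>.\<close>
  define \<iota> where "\<iota> = restrict (\<lambda>a. h (a - 1)) {1..card I}"
  have mono: "strict_mono_on {1..card I} \<iota>"
    by (auto simp: \<iota>_def intro!: strict_mono_onI strict_mono_onD[OF h(2)])
  have "(\<lambda>a. a - 1) ` {1..card I} = {..<card I}"
    by (force simp: image_iff intro: bexI[of _ "Suc _"])
  moreover have "\<iota> ` {1..card I} = h ` (\<lambda>a. a - 1) ` {1..card I}"
    by (simp add: \<iota>_def image_image)
  ultimately have im: "\<iota> ` {1..card I} = I"
    using h(1) by (simp only: bij_betw_def)
  have "inj_on (papply w) (\<iota> ` {1..card I})"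
    by (rule inj_on_subset[OF permutes_inj[OF papply_permutes] subset_UNIV])
  then have "inj_on (\<lambda>a. papply w (\<iota> a)) {1..card I}"
    by (rule comp_inj_on[OF strict_mono_on_imp_inj_on[OF mono], unfolded comp_def])
  then obtain p where p: "psize p = card I"
    "\<And>a b. a \<in> {1..card I} \<Longrightarrow> b \<in> {1..card I} \<Longrightarrow>
       papply p a < papply p b \<longleftrightarrow> papply w (\<iota> a) < papply w (\<iota> b)"
    by (rule standardization_exists) blast
  have "\<iota> \<in> {1..card I} \<rightarrow>\<^sub>E {1..psize w}"
  proof (rule PiE_I)
    show "\<iota> a \<in> {1..psize w}" if "a \<in> {1..card I}" for a
      using imageI[OF that, of \<iota>] I unfolding im by blast
  qed (auto simp: \<iota>_def)
  then have "\<iota> \<in> occurrences p w"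
    using mono p by (simp add: occurrences_def)
  with that im p(1) show thesis by simp
qed

lemma occurrence_comp:
  assumes \<iota>: "\<iota> \<in> occurrences p w" and \<kappa>: "\<kappa> \<in> occurrences q p"
  shows "restrict (\<iota> \<circ> \<kappa>) {1..psize q} \<in> occurrences q w"
  using occurrencesD[OF \<iota>] occurrencesD[OF \<kappa>]
  by (auto simp: occurrences_def PiE_iff strict_mono_on_def)

lemma occurrence_factor:
  assumes \<iota>: "\<iota> \<in> occurrences p w" and \<kappa>: "\<kappa> \<in> occurrences q w"
    and sub: "\<kappa> ` {1..psize q} \<subseteq> \<iota> ` {1..psize p}"
  obtains \<mu> where "\<mu> \<in> occurrences q p" "\<And>b. b \<in> {1..psize q} \<Longrightarrow> \<kappa> b = \<iota> (\<mu> b)"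
proof -
  define \<mu> where "\<mu> = restrict (inv_into {1..psize p} \<iota> \<circ> \<kappa>) {1..psize q}"
  have \<mu>: "\<mu> b \<in> {1..psize p}" "\<iota> (\<mu> b) = \<kappa> b" if "b \<in> {1..psize q}" for b
  proof -
    have "\<kappa> b \<in> \<iota> ` {1..psize p}" using sub that by blast
    from inv_into_into[OF this] f_inv_into_f[OF this] that
    show "\<mu> b \<in> {1..psize p}" "\<iota> (\<mu> b) = \<kappa> b" by (simp_all add: \<mu>_def)
  qed
  have "strict_mono_on {1..psize q} \<mu>"
  proof (rule strict_mono_onI)
    fix a b assume ab: "a \<in> {1..psize q}" "b \<in> {1..psize q}" "a < b"
    then have "\<iota> (\<mu> a) < \<iota> (\<mu> b)"
      using strict_mono_onD[OF occurrencesD(3)[OF \<kappa>]] \<mu>(2) by simp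
    then show "\<mu> a < \<mu> b"
      using strict_mono_on_less[OF occurrencesD(3)[OF \<iota>]] \<mu>(1) ab by simp
  qed
  moreover have "\<mu> \<in> {1..psize q} \<rightarrow>\<^sub>E {1..psize p}"
    using \<mu>(1) by (auto simp: \<mu>_def PiE_iff simp del: atLeastAtMost_iff)
  moreover have "papply q a < papply q b \<longleftrightarrow> papply p (\<mu> a) < papply p (\<mu> b)"
    if "a \<in> {1..psize q}" "b \<in> {1..psize q}" for a b
    using occurrencesD(5)[OF \<iota> \<mu>(1)[OF that(1)] \<mu>(1)[OF that(2)]] occurrencesD(5)[OF \<kappa> that] \<mu>(2) that
    by simp
  ultimately have "\<mu> \<in> occurrences q p"
    unfolding occurrences_def by blast
  with \<mu>(2) show thesis by (metis that)
qed


section \<open>Pattern expansions from sums over sets of positions\<close>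

lemma pattern_finite_sum_subsets:
  fixes G :: "finperm \<Rightarrow> nat set \<Rightarrow> 'a::comm_ring_1"
  assumes loc: "\<And>p w \<iota>. \<iota> \<in> occurrences p w \<Longrightarrow> G w (\<iota> ` {1..psize p}) = G p {1..psize p}"
    and bound: "\<And>w I. card I > K \<Longrightarrow> G w I = 0"
  shows "pattern_finite (\<lambda>w. \<Sum>I\<in>Pow {1..psize w}. G w I)"
proof -
  define c where "c p = G p {1..psize p}" for p
  have "(\<Sum>I\<in>Pow {1..psize w}. G w I) = (\<Sum>p | pattern_count p w \<noteq> 0. c p * of_nat (pattern_count p w))"
    for w
  proof -
    let ?P = "{p. pattern_count p w \<noteq> 0}"
    let ?im = "\<lambda>(p, \<iota>). \<iota> ` {1..psize p}"
    have nonempty: "p \<in> ?P" if "\<iota> \<in> occurrences p w" for p \<iota>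
      using that finite_occurrences[of p w] by (auto simp: pattern_count_def card_gt_0_iff)
    have "bij_betw ?im (SIGMA p:?P. occurrences p w) (Pow {1..psize w})"
    proof (rule bij_betw_imageI)
      show "inj_on ?im (SIGMA p:?P. occurrences p w)"
        by (rule inj_onI) (auto dest: occurrence_unique simp del: One_nat_def)
      show "?im ` (SIGMA p:?P. occurrences p w) = Pow {1..psize w}"
      proof (intro equalityI subsetI)
        fix I assume "I \<in> ?im ` (SIGMA p:?P. occurrences p w)"
        then show "I \<in> Pow {1..psize w}"
          using occurrence_image_subset[OF _ subset_refl] by fastforce
      next
        fix I assume "I \<in> Pow {1..psize w}"
        then obtain p \<iota> where "\<iota> \<in> occurrences p w" "\<iota> ` {1..psize p} = I"
          using occurrence_at by (metis PowD)
        then show "I \<in> ?im ` (SIGMA p:?P. occurrences p w)"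
          using nonempty by (intro image_eqI[of _ _ "(p, \<iota>)"]) auto
      qed
    qed
    then have "(\<Sum>I\<in>Pow {1..psize w}. G w I) = (\<Sum>x\<in>(SIGMA p:?P. occurrences p w). G w (?im x))"
      by (rule sum.reindex_bij_betw[symmetric])
    also have "\<dots> = (\<Sum>p\<in>?P. \<Sum>\<iota>\<in>occurrences p w. G w (\<iota> ` {1..psize p}))"
      by (subst sum.Sigma) (auto simp: finite_occurring_patterns[simplified] finite_occurrences split_def)
    also have "\<dots> = (\<Sum>p\<in>?P. \<Sum>\<iota>\<in>occurrences p w. c p)"
      by (intro sum.cong refl) (simp add: loc c_def del: One_nat_def)
    finally show ?thesis
      by (simp add: pattern_count_def mult.commute)
  qed
  moreover have "finite {p. c p \<noteq> 0}"
  proof (rule finite_subset[OF _ finite_psize_le[of K]])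
    show "{p. c p \<noteq> 0} \<subseteq> {p. psize p \<le> K}"
      using bound by (force simp: c_def not_le[symmetric])
  qed
  ultimately show ?thesis
    unfolding pattern_finite_def is_pattern_expansion_def by blast
qed


section \<open>Local functions of a position and a permutation\<close>

text \<open>
  Invariance is required for all subsets \<open>J\<close> of the pattern, not only for the full set of its
  positions, since a product attributes to \<open>I \<union> J\<close> what \<open>I\<close> and \<open>J\<close> contribute separately.
\<close>

definition occurrence_invariant :: "(finperm \<Rightarrow> nat \<Rightarrow> nat set \<Rightarrow> 'a) \<Rightarrow> bool" where
  "occurrence_invariant F \<longleftrightarrow>
     (\<forall>p w. \<forall>\<iota>\<in>occurrences p w. \<forall>J. J \<subseteq> {1..psize p} \<longrightarrow>
        (\<forall>a\<in>J. F w (\<iota> a) (\<iota> ` J) = F p a J))"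

definition local_function :: "(nat \<Rightarrow> finperm \<Rightarrow> 'a::comm_ring_1) \<Rightarrow> bool" where
  "local_function g \<longleftrightarrow>
     (\<exists>F K. occurrence_invariant F \<and> (\<forall>w i I. card I > K \<longrightarrow> F w i I = 0) \<and>
        (\<forall>w. \<forall>i\<in>{1..psize w}. g i w = (\<Sum>I | I \<subseteq> {1..psize w} \<and> i \<in> I. F w i I)))"

lemma occurrence_invariantI:
  assumes "\<And>p w \<iota> J a. \<iota> \<in> occurrences p w \<Longrightarrow> inj_on \<iota> {1..psize p} \<Longrightarrow> J \<subseteq> {1..psize p} \<Longrightarrow> a \<in> J \<Longrightarrow>
    F w (\<iota> a) (\<iota> ` J) = F p a J"
  shows "occurrence_invariant F"
  unfolding occurrence_invariant_def using assms occurrencesD(4) by blast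

lemma occurrence_invariantD:
  "occurrence_invariant F \<Longrightarrow> \<iota> \<in> occurrences p w \<Longrightarrow> J \<subseteq> {1..psize p} \<Longrightarrow> a \<in> J \<Longrightarrow>
    F w (\<iota> a) (\<iota> ` J) = F p a J"
  unfolding occurrence_invariant_def by blast

lemma local_function_const: "local_function (\<lambda>i w. c)"
proof -
  let ?F = "\<lambda>w i I. if I = {i} then c else 0"
  have "occurrence_invariant ?F"
  proof (rule occurrence_invariantI)
    fix p w \<iota> J a
    assume "inj_on \<iota> {1..psize p}" "J \<subseteq> {1..psize p}" "a \<in> J"
    then have "\<iota> ` J = \<iota> ` {a} \<longleftrightarrow> J = {a}"
      by (intro inj_on_image_eq_iff[of _ "{1..psize p}"]) auto
    then show "?F w (\<iota> a) (\<iota> ` J) = ?F p a J" by simp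
  qed
  moreover have "c = (\<Sum>I | I \<subseteq> {1..n} \<and> i \<in> I. if I = {i} then c else 0)" if "i \<in> {1..n}" for n i :: nat
    using that by (simp add: sum.delta)
  ultimately show ?thesis
    unfolding local_function_def by (intro exI[of _ ?F] exI[of _ 1]) auto
qed

lemma local_function_add:
  assumes "local_function g" "local_function g'"
  shows "local_function (\<lambda>i w. g i w + g' i w)"
proof -
  obtain F K where F: "occurrence_invariant F" "\<And>w i I. card I > K \<Longrightarrow> F w i I = 0"
    "\<And>w i. i \<in> {1..psize w} \<Longrightarrow> g i w = (\<Sum>I | I \<subseteq> {1..psize w} \<and> i \<in> I. F w i I)"
    using assms(1) unfolding local_function_def by blast
  obtain F' K' where F': "occurrence_invariant F'" "\<And>w i I. card I > K' \<Longrightarrow> F' w i I = 0"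
    "\<And>w i. i \<in> {1..psize w} \<Longrightarrow> g' i w = (\<Sum>I | I \<subseteq> {1..psize w} \<and> i \<in> I. F' w i I)"
    using assms(2) unfolding local_function_def by blast
  have "occurrence_invariant (\<lambda>w i I. F w i I + F' w i I)"
    using occurrence_invariantD[OF F(1)] occurrence_invariantD[OF F'(1)]
    by (intro occurrence_invariantI) simp
  then show ?thesis
    unfolding local_function_def
    by (intro exI[of _ "\<lambda>w i I. F w i I + F' w i I"] exI[of _ "max K K'"])
       (simp add: F(2,3) F'(2,3) sum.distrib)
qed

text \<open>
  The contribution of \<open>U\<close> to the product runs over the pairs \<open>(I, J)\<close> with \<open>I \<union> J = U\<close> and \<open>i\<close> in
  both. An occurrence \<open>\<iota>\<close> maps the pairs for \<open>U\<close> bijectively to the pairs for \<open>\<iota> ` U\<close>, which gives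
  invariance. If \<open>U\<close> has more than \<open>K + K'\<close> elements, then \<open>I\<close> has more than \<open>K\<close> or \<open>J\<close> more than
  \<open>K'\<close>.
\<close>

lemma local_function_mult:
  assumes "local_function g" "local_function g'"
  shows "local_function (\<lambda>i w. g i w * g' i w)"
proof -
  obtain F K where F: "occurrence_invariant F" "\<And>w i I. card I > K \<Longrightarrow> F w i I = 0"
    "\<And>w i. i \<in> {1..psize w} \<Longrightarrow> g i w = (\<Sum>I | I \<subseteq> {1..psize w} \<and> i \<in> I. F w i I)"
    using assms(1) unfolding local_function_def by blast
  obtain F' K' where F': "occurrence_invariant F'" "\<And>w i I. card I > K' \<Longrightarrow> F' w i I = 0"
    "\<And>w i. i \<in> {1..psize w} \<Longrightarrow> g' i w = (\<Sum>I | I \<subseteq> {1..psize w} \<and> i \<in> I. F' w i I)"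
    using assms(2) unfolding local_function_def by blast
  define S where "S i U = {(I, J). i \<in> I \<and> i \<in> J \<and> I \<union> J = U}" for i :: nat and U
  define H where "H w i U = (\<Sum>(I, J)\<in>S i U. F w i I * F' w i J)" for w i U
  have "occurrence_invariant H"
  proof (rule occurrence_invariantI)
    fix p w \<iota> U a
    assume \<iota>: "\<iota> \<in> occurrences p w" and inj: "inj_on \<iota> {1..psize p}"
      and U: "U \<subseteq> {1..psize p}" and a: "a \<in> U"
    have injU: "inj_on \<iota> U" using inj U by (rule inj_on_subset)
    let ?m = "map_prod ((`) \<iota>) ((`) \<iota>)"
    have "bij_betw ?m (S a U) (S (\<iota> a) (\<iota> ` U))"
    proof (rule bij_betw_imageI)
      have "inj_on ?m (Pow U \<times> Pow U)"
        by (intro map_prod_inj_on inj_on_image_Pow injU)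
      then show "inj_on ?m (S a U)"
        by (rule inj_on_subset) (auto simp: S_def)
      show "?m ` S a U = S (\<iota> a) (\<iota> ` U)"
      proof (intro equalityI subsetI)
        fix x assume "x \<in> ?m ` S a U"
        then show "x \<in> S (\<iota> a) (\<iota> ` U)" by (auto simp: S_def)
      next
        fix x assume "x \<in> S (\<iota> a) (\<iota> ` U)"
        then obtain I J where x: "x = (I, J)" "\<iota> a \<in> I" "\<iota> a \<in> J" "I \<union> J = \<iota> ` U"
          by (auto simp: S_def)
        \<comment> \<open>\<open>I\<close> and \<open>J\<close> lie inside \<open>\<iota> ` U\<close>, so they are the images of their preimages in \<open>U\<close>.\<close>
        let ?I = "{b \<in> U. \<iota> b \<in> I}" and ?J = "{b \<in> U. \<iota> b \<in> J}"
        have "I \<subseteq> \<iota> ` U" "J \<subseteq> \<iota> ` U"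
          using x(4) by auto
        then have "\<iota> ` ?I = I" "\<iota> ` ?J = J"
          by auto
        moreover have "?I \<union> ?J = U"
          using x(4) by auto
        ultimately have "x = ?m (?I, ?J)" "(?I, ?J) \<in> S a U"
          using x(1-3) a by (simp_all add: S_def)
        then show "x \<in> ?m ` S a U"
          by (rule image_eqI)
      qed
    qed
    then have "H w (\<iota> a) (\<iota> ` U) =
        (\<Sum>x\<in>S a U. case ?m x of (I, J) \<Rightarrow> F w (\<iota> a) I * F' w (\<iota> a) J)"
      unfolding H_def by (rule sum.reindex_bij_betw[symmetric])
    also have "\<dots> = H p a U"
      unfolding H_def
    proof (intro sum.cong refl)
      fix x assume "x \<in> S a U"
      then obtain I J where "x = (I, J)" "a \<in> I" "a \<in> J" "I \<subseteq> {1..psize p}" "J \<subseteq> {1..psize p}"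
        using U by (auto simp: S_def)
      then show "(case ?m x of (I, J) \<Rightarrow> F w (\<iota> a) I * F' w (\<iota> a) J) =
          (case x of (I, J) \<Rightarrow> F p a I * F' p a J)"
        by (simp add: occurrence_invariantD[OF F(1) \<iota>] occurrence_invariantD[OF F'(1) \<iota>])
    qed
    finally show "H w (\<iota> a) (\<iota> ` U) = H p a U" .
  qed
  moreover have "H w i U = 0" if U: "card U > K + K'" for w i U
  proof -
    have "F w i I * F' w i J = 0" if "I \<union> J = U" for I J
    proof -
      have "K < card I \<or> K' < card J"
        using U card_Un_le[of I J] unfolding that by linarith
      then show ?thesis using F(2) F'(2) by auto
    qed
    then show ?thesis
      unfolding H_def by (intro sum.neutral) (auto simp: S_def)
  qed
  moreover have "g i w * g' i w = (\<Sum>U | U \<subseteq> {1..psize w} \<and> i \<in> U. H w i U)"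
    if i: "i \<in> {1..psize w}" for i w
  proof -
    let ?A = "{I. I \<subseteq> {1..psize w} \<and> i \<in> I}"
    let ?t = "\<lambda>(I, J). F w i I * F' w i J"
    have "g i w * g' i w = (\<Sum>x\<in>?A \<times> ?A. ?t x)"
      by (simp add: F(3)[OF i] F'(3)[OF i] sum_product sum.cartesian_product)
    also have "\<dots> = (\<Sum>U\<in>?A. \<Sum>x | x \<in> ?A \<times> ?A \<and> (case x of (I, J) \<Rightarrow> I \<union> J) = U. ?t x)"
      by (rule sum.group[symmetric]) (auto intro: finite_cartesian_product)
    also have "\<dots> = (\<Sum>U\<in>?A. H w i U)"
      unfolding H_def by (intro sum.cong refl) (auto simp: S_def)
    finally show ?thesis .
  qed
  ultimately show ?thesis
    unfolding local_function_def by blast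
qed

lemma local_function_sum:
  "(\<And>x. x \<in> A \<Longrightarrow> local_function (g x)) \<Longrightarrow> local_function (\<lambda>i w. \<Sum>x\<in>A. g x i w)"
  by (induction A rule: infinite_finite_induct) (simp_all add: local_function_const local_function_add)

lemma local_function_prod:
  "(\<And>x. x \<in> A \<Longrightarrow> local_function (g x)) \<Longrightarrow> local_function (\<lambda>i w. \<Prod>x\<in>A. g x i w)"
  by (induction A rule: infinite_finite_induct) (simp_all add: local_function_const local_function_mult)

lemma local_function_power: "local_function g \<Longrightarrow> local_function (\<lambda>i w. g i w ^ n)"
  by (induction n) (simp_all add: local_function_const local_function_mult)

text \<open>
  A set \<open>I\<close> of positions supports at most one occurrence of \<open>q\<close>, so a calibrated count is the number
  of sets that support one with \<open>i\<close> as its \<open>h\<close>-th position. Invariance holds because an occurrence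
  of \<open>q\<close> inside an occurrence of \<open>p\<close> is the same as an occurrence of \<open>q\<close> in \<open>p\<close>.
\<close>

lemma local_function_calibrated_count:
  assumes "(q, h) \<in> marked_perms"
  shows "local_function (\<lambda>i w. of_nat (calibrated_count (q, h) i w) :: 'a::comm_ring_1)"
proof -
  have h: "h \<in> {1..psize q}" using assms by (simp add: marked_perms_def)
  let ?Q = "\<lambda>w i I. \<exists>\<kappa>\<in>occurrences q w. \<kappa> ` {1..psize q} = I \<and> \<kappa> h = i"
  let ?F = "\<lambda>w i I. of_bool (?Q w i I) :: 'a"
  have "occurrence_invariant ?F"
  proof (rule occurrence_invariantI)
    fix p w \<iota> J a
    assume \<iota>: "\<iota> \<in> occurrences p w" and inj: "inj_on \<iota> {1..psize p}"
      and J: "J \<subseteq> {1..psize p}" and a: "a \<in> J"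
    have "?Q w (\<iota> a) (\<iota> ` J) \<longleftrightarrow> ?Q p a J"
    proof
      assume "?Q w (\<iota> a) (\<iota> ` J)"
      then obtain \<kappa> where \<kappa>: "\<kappa> \<in> occurrences q w" "\<kappa> ` {1..psize q} = \<iota> ` J" "\<kappa> h = \<iota> a"
        by blast
      then obtain \<mu> where \<mu>: "\<mu> \<in> occurrences q p" "\<And>b. b \<in> {1..psize q} \<Longrightarrow> \<kappa> b = \<iota> (\<mu> b)"
        using occurrence_factor[OF \<iota> \<kappa>(1)] image_mono[OF J, of \<iota>] unfolding \<kappa>(2) by blast
      have "\<iota> ` \<mu> ` {1..psize q} = \<kappa> ` {1..psize q}"
        unfolding image_image using \<mu>(2) by (intro image_cong refl) simp
      then have "\<iota> ` \<mu> ` {1..psize q} = \<iota> ` J"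
        using \<kappa>(2) by simp
      then have "\<mu> ` {1..psize q} = J"
        by (rule inj_on_image_eq_iff[OF inj occurrence_image_subset[OF \<mu>(1) subset_refl] J, THEN iffD1])
      moreover have "\<mu> h = a"
        using inj_onD[OF inj] \<mu>(2)[OF h] \<kappa>(3) occurrencesD(2)[OF \<mu>(1) h] a J by auto
      ultimately show "?Q p a J" using \<mu>(1) by blast
    next
      assume "?Q p a J"
      then obtain \<mu> where \<mu>: "\<mu> \<in> occurrences q p" "\<mu> ` {1..psize q} = J" "\<mu> h = a"
        by blast
      let ?\<kappa> = "restrict (\<iota> \<circ> \<mu>) {1..psize q}"
      have "?\<kappa> ` {1..psize q} = \<iota> ` J" "?\<kappa> h = \<iota> a"
        using \<mu>(2,3) h by (auto simp: image_comp[symmetric])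
      then show "?Q w (\<iota> a) (\<iota> ` J)"
        using occurrence_comp[OF \<iota> \<mu>(1)] by blast
    qed
    then show "?F w (\<iota> a) (\<iota> ` J) = ?F p a J" by simp
  qed
  moreover have "?F w i I = 0" if "card I > psize q" for w i I
    using that card_occurrence_image by fastforce
  moreover have "of_nat (calibrated_count (q, h) i w) = (\<Sum>I | I \<subseteq> {1..psize w} \<and> i \<in> I. ?F w i I)"
    for w i
  proof -
    let ?O = "{\<kappa> \<in> occurrences q w. \<kappa> h = i}"
    have "inj_on (\<lambda>\<kappa>. \<kappa> ` {1..psize q}) ?O"
      by (rule inj_onI) (auto dest: occurrence_unique simp del: One_nat_def)
    then have "card ?O = card ((\<lambda>\<kappa>. \<kappa> ` {1..psize q}) ` ?O)"
      by (rule card_image[symmetric])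
    also have "(\<lambda>\<kappa>. \<kappa> ` {1..psize q}) ` ?O = {I \<in> {I. I \<subseteq> {1..psize w} \<and> i \<in> I}. ?Q w i I}"
      using h occurrence_image_subset[OF _ subset_refl, of _ q w] by blast
    finally show ?thesis
      by (simp add: calibrated_count_def sum_of_bool_eq Int_def)
  qed
  ultimately show ?thesis
    unfolding local_function_def by (intro exI[of _ ?F] exI[of _ "psize q"]) blast
qed

lemma pattern_finite_sum_local:
  assumes "local_function g"
  shows "pattern_finite (\<lambda>w. \<Sum>i = 1..psize w. g i w)"
proof -
  obtain F K where F: "occurrence_invariant F" "\<And>w i I. card I > K \<Longrightarrow> F w i I = 0"
    "\<And>w i. i \<in> {1..psize w} \<Longrightarrow> g i w = (\<Sum>I | I \<subseteq> {1..psize w} \<and> i \<in> I. F w i I)"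
    using assms unfolding local_function_def by blast
  have "(\<Sum>i = 1..psize w. g i w) = (\<Sum>I\<in>Pow {1..psize w}. \<Sum>i\<in>I. F w i I)" for w
  proof -
    have "(\<Sum>i = 1..psize w. g i w) = (\<Sum>i = 1..psize w. \<Sum>I | I \<in> Pow {1..psize w} \<and> i \<in> I. F w i I)"
      using F(3) by simp
    also have "\<dots> = (\<Sum>I\<in>Pow {1..psize w}. \<Sum>i | i \<in> {1..psize w} \<and> i \<in> I. F w i I)"
      by (rule sum.swap_restrict) auto
    also have "\<dots> = (\<Sum>I\<in>Pow {1..psize w}. \<Sum>i\<in>I. F w i I)"
      by (intro sum.cong refl) auto
    finally show ?thesis .
  qed
  moreover have "pattern_finite (\<lambda>w. \<Sum>I\<in>Pow {1..psize w}. \<Sum>i\<in>I. F w i I)"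
  proof (rule pattern_finite_sum_subsets[where K = K])
    fix p w \<iota> assume \<iota>: "\<iota> \<in> occurrences p w"
    have "(\<Sum>i\<in>\<iota> ` {1..psize p}. F w i (\<iota> ` {1..psize p})) =
        (\<Sum>a\<in>{1..psize p}. F w (\<iota> a) (\<iota> ` {1..psize p}))"
      using occurrencesD(4)[OF \<iota>] by (simp add: sum.reindex)
    also have "\<dots> = (\<Sum>a\<in>{1..psize p}. F p a {1..psize p})"
      using occurrence_invariantD[OF F(1) \<iota>] by (intro sum.cong) auto
    finally show "(\<Sum>i\<in>\<iota> ` {1..psize p}. F w i (\<iota> ` {1..psize p})) =
        (\<Sum>a\<in>{1..psize p}. F p a {1..psize p})" .
  qed (simp add: F(2))
  ultimately show ?thesis by simp
qed


section \<open>Polynomials in calibrated counts\<close>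

lemma local_function_calibrated_term:
  fixes f :: "'a::comm_ring_1 mpoly"
  assumes "\<forall>j\<in>{1..s}. m j \<in> marked_perms" "f \<in> mpolys s"
  shows "local_function (calibrated_term f m)"
proof -
  have count: "local_function (\<lambda>i w. of_nat (calibrated_count (m j) i w) :: 'a)"
    if "e \<in> Poly_Mapping.keys f" "j \<in> Poly_Mapping.keys e" for e j
  proof -
    have "Poly_Mapping.keys e \<subseteq> {1..s}" using assms(2) that(1) by (simp add: mpolys_def)
    then have "m j \<in> marked_perms" using assms(1) that(2) by blast
    then show ?thesis
      using local_function_calibrated_count[of "fst (m j)" "snd (m j)"] by simp
  qed
  have "local_function (\<lambda>i w. calibrated_term f m i w)"
    unfolding calibrated_term_def mpoly_eval_def
    by (rule local_function_sum, rule local_function_mult[OF local_function_const],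
        rule local_function_prod, rule local_function_power, rule count)
  then show ?thesis by simp
qed

lemma calibrated_count_outside:
  assumes "mk \<in> marked_perms" "i \<notin> {1..psize w}"
  shows "calibrated_count mk i w = 0"
proof -
  have "snd mk \<in> {1..psize (fst mk)}"
    using assms(1) by (auto simp: marked_perms_def)
  then have "\<iota> (snd mk) \<noteq> i" if "\<iota> \<in> occurrences (fst mk) w" for \<iota>
    using occurrencesD(2)[OF that] assms(2) by blast
  then have "{\<iota> \<in> occurrences (fst mk) w. \<iota> (snd mk) = i} = {}"
    by blast
  then show ?thesis by (simp only: calibrated_count_def card.empty)
qed

lemma calibrated_term_outside:
  fixes f :: "'a::comm_ring_1 mpoly"
  assumes "\<forall>j\<in>{1..s}. m j \<in> marked_perms" "f \<in> mpolys s"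
    and const: "Poly_Mapping.lookup f 0 = 0" and i: "i \<notin> {1..psize w}"
  shows "calibrated_term f m i w = 0"
  unfolding calibrated_term_def mpoly_eval_def
proof (intro sum.neutral ballI)
  fix e assume e: "e \<in> Poly_Mapping.keys f"
  with const have "e \<noteq> 0" by (auto simp: in_keys_iff)
  then obtain j where j: "j \<in> Poly_Mapping.keys e" using keys_eq_empty by blast
  moreover have "Poly_Mapping.keys e \<subseteq> {1..s}" using assms(2) e by (simp add: mpolys_def)
  ultimately have "m j \<in> marked_perms" using assms(1) by blast
  then have "(of_nat (calibrated_count (m j) i w) :: 'a) ^ Poly_Mapping.lookup e j = 0"
    using j calibrated_count_outside[OF _ i] by (simp add: in_keys_iff power_0_left)
  then have "(\<Prod>j\<in>Poly_Mapping.keys e. (of_nat (calibrated_count (m j) i w) :: 'a) ^ Poly_Mapping.lookup e j) = 0"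
    using j by (intro prod_zero) auto
  then show "Poly_Mapping.lookup f e *
      (\<Prod>j\<in>Poly_Mapping.keys e. of_nat (calibrated_count (m j) i w) ^ Poly_Mapping.lookup e j) = 0"
    by simp
qed

theorem theorem3p6:
  fixes s :: nat
    and m :: "nat \<Rightarrow> finperm \<times> nat"
    and f :: "'a::comm_ring_1 mpoly"
  assumes "\<forall>j\<in>{1..s}. m j \<in> marked_perms"
    and "f \<in> mpolys s"
  shows "(Poly_Mapping.lookup f 0 = 0 \<longrightarrow>
            (\<forall>w. finite {i. 1 \<le> i \<and> calibrated_term f m i w \<noteq> 0}) \<and>
            pattern_finite (\<lambda>w. \<Sum>i | 1 \<le> i \<and> calibrated_term f m i w \<noteq> 0. calibrated_term f m i w))
       \<and> pattern_finite (\<lambda>w. \<Sum>i = 1..psize w. calibrated_term f m i w)"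
proof (intro conjI impI allI)
  show fin: "pattern_finite (\<lambda>w. \<Sum>i = 1..psize w. calibrated_term f m i w)"
    using local_function_calibrated_term[OF assms] by (rule pattern_finite_sum_local)
  assume const: "Poly_Mapping.lookup f 0 = 0"
  have sub: "{i. 1 \<le> i \<and> calibrated_term f m i w \<noteq> 0} \<subseteq> {1..psize w}" for w
    using calibrated_term_outside[OF assms const] by blast
  then show "finite {i. 1 \<le> i \<and> calibrated_term f m i w \<noteq> 0}" for w
    by (rule finite_subset) simp
  have "(\<Sum>i | 1 \<le> i \<and> calibrated_term f m i w \<noteq> 0. calibrated_term f m i w) =
      (\<Sum>i = 1..psize w. calibrated_term f m i w)" for w
    using sub by (intro sum.mono_neutral_left) auto
  with fin show "pattern_finite
      (\<lambda>w. \<Sum>i | 1 \<le> i \<and> calibrated_term f m i w \<noteq> 0. calibrated_term f m i w)"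
    by simp
qed

end
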